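(* Let $n\ge1$ and $\widetilde\rho>0$ be fixed. For $k\to0$ (with $k\ne0$) the following asymptotic relations hold: $$E_q-E_c=-\frac{n\widetilde\rho\,kC_0}{4\,(2^{n/2})}+O(k^2),\qquad S_q-S_c=-\frac{(n-2)\widetilde\rho\,kC_0}{4\,(2^{n/2})}+O(k^2),$$ $$F_q-F_c=\frac{\widetilde\rho\,kC_0}{2\,(2^{n/2})}+O(k^2),$$ where $E_q=E(M_k)$, $S_q=S(M_k)$, $F_q=F(M_k)$ and $E_c=E(M_0)$, $S_c=S(M_0)$, $F_c=F(M_0)$.
   Context: $\Omega\subset\mathbb{R}^n$ is a bounded domain of volume $V_\Omega$, and $\widetilde\rho>0$ is a fixed total density. For $k\in\mathbb{R}$ with $|k|$ small, $C_k$ denotes the unique constant with $C_k>0$, $kC_k<1$ and $$V_\Omega\int_{\mathbb{R}^n}\frac{C_k e^{-|v|^2/2}}{1-kC_ke^{-|v|^2/2}}\,dv=\widetilde\rho,$$ and $M_k(v)=\dfrac{C_ke^{-|v|^2/2}}{1-kC_ke^{-|v|^2/2}}$. In particular $C_0=(2\pi)^{-n/2}\widetilde\rho/V_\Omega$. Set $\Phi(f)=f\log f$ for $k=0$ and $\Phi(f)=f\log f-\frac1k(1+kf)\log(1+kf)+f$ for $k\ne0$. Then $S(M_k)=-\int_\Omega\int_{\mathbb{R}^n}\Phi(M_k)\,dv\,dx$ (with $\Phi$ corresponding to the same $k$), $E(M_k)=\int_\Omega\int_{\mathbb{R}^n}\frac{|v|^2}{2}M_k\,dv\,dx$, and $F(M_k)=S(M_k)-E(M_k)$.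 *)

theory Defs
  imports "HOL-Analysis.Analysis" "HOL-Library.Landau_Symbols"
begin

definition bounded_domain :: "'a::euclidean_space set \<Rightarrow> bool" where
  "bounded_domain \<Omega> \<longleftrightarrow> open \<Omega> \<and> connected \<Omega> \<and> \<Omega> \<noteq> {} \<and> bounded \<Omega>"

definition quantum_profile :: "real \<Rightarrow> real \<Rightarrow> 'a::euclidean_space \<Rightarrow> real" where
  "quantum_profile k c v = c * exp (- (norm v)\<^sup>2 / 2) / (1 - k * c * exp (- (norm v)\<^sup>2 / 2))"

(* The unique normalising constant C_k. It is meaningful for |k| small, where existence and
   uniqueness hold; for c > 0 and k * c < 1 the integrand is positive and integrable. *)
definition normalising_const :: "'a::euclidean_space set \<Rightarrow> real \<Rightarrow> real \<Rightarrow> real" where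
  "normalising_const \<Omega> \<rho> k =
     (THE c. c > 0 \<and> k * c < 1 \<and>
             measure lborel \<Omega> * (LINT v|lborel. quantum_profile k c (v::'a)) = \<rho>)"

definition quantum_maxwellian ::
    "'a::euclidean_space set \<Rightarrow> real \<Rightarrow> real \<Rightarrow> 'a \<Rightarrow> real" where
  "quantum_maxwellian \<Omega> \<rho> k = quantum_profile k (normalising_const \<Omega> \<rho> k)"

definition entropy_density :: "real \<Rightarrow> real \<Rightarrow> real" where
  "entropy_density k f =
     (if k = 0 then f * ln f
      else f * ln f - (1 / k) * (1 + k * f) * ln (1 + k * f) + f)"

(* The functionals act on phase-space densities f x v, with position x and velocity v. *)

definition entropy ::
    "'a::euclidean_space set \<Rightarrow> real \<Rightarrow> ('a \<Rightarrow> 'a \<Rightarrow> real) \<Rightarrow> real" where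
  "entropy \<Omega> k f = - (LINT x:\<Omega>|lborel. (LINT v|lborel. entropy_density k (f x v)))"

definition energy :: "'a::euclidean_space set \<Rightarrow> ('a \<Rightarrow> 'a \<Rightarrow> real) \<Rightarrow> real" where
  "energy \<Omega> f = (LINT x:\<Omega>|lborel. (LINT v|lborel. (norm v)\<^sup>2 / 2 * f x v))"

definition free_energy ::
    "'a::euclidean_space set \<Rightarrow> real \<Rightarrow> ('a \<Rightarrow> 'a \<Rightarrow> real) \<Rightarrow> real" where
  "free_energy \<Omega> k f = entropy \<Omega> k f - energy \<Omega> f"

end

theory Submission
  imports "HOL-Probability.Distributions" Defs
begin

text \<open>Write \<open>g v = exp (- |v|\<^sup>2 / 2)\<close>, let \<open>V\<close> be the volume of \<open>\<Omega>\<close>, \<open>Z = (2 \<pi>)\<^bsup>n/2\<^esup>\<close> the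
integral of \<open>g\<close>, and \<open>q = 2\<^bsup>- n/2\<^esup>\<close>. For \<open>|k c| \<le> 1/2\<close> the profile is
\<open>c g + k c\<^sup>2 g\<^sup>2\<close> up to an error at most \<open>2 k\<^sup>2 c\<^sup>3 g\<close>, and \<open>- ln (1 - k c g) / k\<close> is
\<open>c g + k c\<^sup>2 g\<^sup>2 / 2\<close> up to the same error. The integrals of \<open>g\<close>, \<open>g\<^sup>2\<close>, \<open>|v|\<^sup>2 g / 2\<close> and
\<open>|v|\<^sup>2 g\<^sup>2 / 2\<close> are \<open>Z\<close>, \<open>Z q\<close>, \<open>n Z / 2\<close> and \<open>n Z q / 4\<close> (\<open>maxwellian_moments\<close>). Hence,
with \<open>c = C\<^sub>k\<close> and up to \<open>O(k\<^sup>2)\<close>, the mass is \<open>V Z (c + q k c\<^sup>2)\<close>, the energy is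
\<open>V (n/2) Z (c + q k c\<^sup>2 / 2)\<close>, and \<open>V\<close> times the integral of the logarithm is
\<open>V Z (c + q k c\<^sup>2 / 2)\<close>.

The mass is continuous and strictly increasing in \<open>c\<close>, so for small \<open>k\<close> the constant
\<open>C\<^sub>k\<close> is well defined and lies in \<open>[C\<^sub>0/2, 2 C\<^sub>0]\<close> (\<open>normalising_const_range_and_mass\<close>). This a priori
bound makes all remainders \<open>O(k\<^sup>2)\<close>, and the mass constraint
\<open>C\<^sub>k + q k C\<^sub>k\<^sup>2 = C\<^sub>0 + O(k\<^sup>2)\<close> yields \<open>C\<^sub>k = C\<^sub>0 - q k C\<^sub>0\<^sup>2 + O(k\<^sup>2)\<close>
(\<open>fugacity_asymptotics\<close>). The energy asymptotics follow by substitution.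

For the entropy, \<open>M / (1 + k M) = c g\<close> and \<open>1 + k M = 1 / (1 - k c g)\<close> give
\<open>S(M\<^sub>k) = - \<rho> ln C\<^sub>k + E(M\<^sub>k) - \<rho> + V \<integral> - ln (1 - k C\<^sub>k g) / k\<close> (\<open>entropy_quantum\<close>),
where the last two terms cancel to leading order, while \<open>S(M\<^sub>0) = - \<rho> ln C\<^sub>0 + E(M\<^sub>0)\<close>. The free
energy is the difference of the two.\<close>

section \<open>Gaussian moments\<close>

lemma has_bochner_integral_lborel_prod:
  fixes f :: "'a::euclidean_space \<Rightarrow> real \<Rightarrow> real"
  assumes f: "\<And>b. b \<in> Basis \<Longrightarrow> has_bochner_integral lborel (f b) (I b)"
    and nonneg: "\<And>b x. b \<in> Basis \<Longrightarrow> 0 \<le> f b x"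
  shows "has_bochner_integral lborel (\<lambda>v. \<Prod>b\<in>Basis. f b (v \<bullet> b)) (\<Prod>b\<in>Basis. I b)"
proof (rule has_bochner_integral_nn_integral)
  have meas: "f b \<in> borel_measurable borel" if "b \<in> Basis" for b
    using borel_measurable_has_bochner_integral[OF f[OF that]] by simp
  then show "(\<lambda>v. \<Prod>b\<in>Basis. f b (v \<bullet> b)) \<in> borel_measurable lborel"
    by (intro borel_measurable_prod) (auto intro: measurable_compose[of "\<lambda>v. v \<bullet> _" lborel borel])
  have I: "0 \<le> I b" if "b \<in> Basis" for b
    using f[OF that] Bochner_Integration.integral_nonneg[of lborel "f b"] nonneg[OF that]
    by (simp add: has_bochner_integral_iff)
  show "AE v in lborel. 0 \<le> (\<Prod>b\<in>Basis. f b (v \<bullet> b))"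
    by (simp add: nonneg prod_nonneg)
  show "0 \<le> (\<Prod>b\<in>Basis. I b)"
    by (simp add: I prod_nonneg)
  have "(\<integral>\<^sup>+ v. ennreal (\<Prod>b\<in>Basis. f b (v \<bullet> b)) \<partial>lborel)
      = (\<integral>\<^sup>+ v. (\<Prod>b\<in>Basis. ennreal (f b (v \<bullet> b))) \<partial>(lborel :: 'a measure))"
    by (simp add: prod_ennreal nonneg)
  also have "\<dots> = (\<Prod>b\<in>Basis. \<integral>\<^sup>+ x. ennreal (f b x) \<partial>lborel)"
    using meas by (subst nn_integral_lborel_prod) auto
  also have "\<dots> = (\<Prod>b\<in>Basis. ennreal (I b))"
  proof (intro prod.cong refl)
    fix b :: 'a assume b: "b \<in> Basis"
    have "integrable lborel (f b)" "integral\<^sup>L lborel (f b) = I b"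
      using f[OF b] by (auto simp: has_bochner_integral_iff)
    then show "(\<integral>\<^sup>+ x. ennreal (f b x) \<partial>lborel) = ennreal (I b)"
      using nonneg[OF b] by (subst nn_integral_eq_integral) auto
  qed
  also have "\<dots> = ennreal (\<Prod>b\<in>Basis. I b)"
    by (simp add: prod_ennreal I)
  finally show "(\<integral>\<^sup>+ v. ennreal (\<Prod>b\<in>Basis. f b (v \<bullet> b)) \<partial>lborel) = ennreal (\<Prod>b\<in>Basis. I b)" .
qed

lemma exp_norm_square_eq_prod:
  fixes v :: "'a::euclidean_space"
  shows "exp (- (a * (norm v)\<^sup>2 / 2)) = (\<Prod>b\<in>Basis. exp (- (a * (v \<bullet> b)\<^sup>2 / 2)))"
  unfolding euclidean_inner[of v v, folded power2_norm_eq_inner]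
  by (simp add: power2_eq_square sum_distrib_left sum_divide_distrib exp_sum flip: sum_negf)

lemma has_bochner_integral_gaussian_1:
  fixes a :: real
  assumes "a > 0"
  shows "has_bochner_integral lborel (\<lambda>x::real. exp (- (a * x\<^sup>2 / 2))) (sqrt (2 * pi / a))"
    and "has_bochner_integral lborel (\<lambda>x::real. x\<^sup>2 * exp (- (a * x\<^sup>2 / 2))) (sqrt (2 * pi / a) / a)"
proof -
  define \<sigma> where "\<sigma> = 1 / sqrt a"
  have \<sigma>: "\<sigma> > 0" "\<sigma>\<^sup>2 = 1 / a"
    using assms by (auto simp: \<sigma>_def power_divide)
  have density: "sqrt (2 * pi / a) * normal_density 0 \<sigma> x = exp (- (a * x\<^sup>2 / 2))" for x
    using assms by (simp add: normal_density_def \<sigma> mult.commute)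
  show "has_bochner_integral lborel (\<lambda>x::real. exp (- (a * x\<^sup>2 / 2))) (sqrt (2 * pi / a))"
    using has_bochner_integral_mult_right[OF normal_moment_even[of \<sigma> 0 0, OF \<sigma>(1)], of "sqrt (2 * pi / a)"]
    by (simp add: density)
  show "has_bochner_integral lborel (\<lambda>x::real. x\<^sup>2 * exp (- (a * x\<^sup>2 / 2))) (sqrt (2 * pi / a) / a)"
    using has_bochner_integral_mult_right[OF normal_moment_even[of \<sigma> 0 1, OF \<sigma>(1)], of "sqrt (2 * pi / a)"]
    by (simp add: density mult.assoc[symmetric] \<sigma>) (simp add: mult.commute)
qed

lemma has_bochner_integral_gaussian:
  assumes "a > 0"
  shows "has_bochner_integral lborel (\<lambda>v::'a::euclidean_space. exp (- (a * (norm v)\<^sup>2 / 2)))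
           (sqrt (2 * pi / a) ^ DIM('a))"
  using has_bochner_integral_lborel_prod[where 'a = 'a, OF has_bochner_integral_gaussian_1(1)[OF assms]]
  by (simp add: exp_norm_square_eq_prod)

lemma has_bochner_integral_gaussian_energy:
  assumes "a > 0"
  shows "has_bochner_integral lborel
           (\<lambda>v::'a::euclidean_space. (norm v)\<^sup>2 / 2 * exp (- (a * (norm v)\<^sup>2 / 2)))
           (real DIM('a) / (2 * a) * sqrt (2 * pi / a) ^ DIM('a))"
proof -
  let ?e = "\<lambda>x::real. exp (- (a * x\<^sup>2 / 2))"
  let ?I = "sqrt (2 * pi / a)"
  have coord: "has_bochner_integral lborel (\<lambda>v::'a. (v \<bullet> b)\<^sup>2 * exp (- (a * (norm v)\<^sup>2 / 2)))
          (?I ^ DIM('a) / a)" if b: "b \<in> Basis" for b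
  proof -
    have "has_bochner_integral lborel
            (\<lambda>v::'a. \<Prod>b'\<in>Basis. (if b' = b then (v \<bullet> b')\<^sup>2 * ?e (v \<bullet> b') else ?e (v \<bullet> b')))
            (\<Prod>b'\<in>Basis. if b' = b then ?I / a else ?I)"
      using has_bochner_integral_lborel_prod[where 'a = 'a and
          f = "\<lambda>b' x. if b' = b then x\<^sup>2 * ?e x else ?e x" and
          I = "\<lambda>b'. if b' = b then ?I / a else ?I"]
        has_bochner_integral_gaussian_1[OF assms]
      by (auto simp: if_distrib cong: if_cong)
    moreover have "(\<Prod>b'\<in>Basis. (if b' = b then (v \<bullet> b')\<^sup>2 * ?e (v \<bullet> b') else ?e (v \<bullet> b')))
        = (v \<bullet> b)\<^sup>2 * exp (- (a * (norm v)\<^sup>2 / 2))" for v :: 'a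
      unfolding exp_norm_square_eq_prod
      by (simp add: prod.remove[OF finite_Basis b] mult.assoc)
    moreover have "(\<Prod>b'\<in>(Basis :: 'a set). if b' = b then ?I / a else ?I) = ?I ^ DIM('a) / a"
    proof -
      have "?I ^ DIM('a) = (\<Prod>b'\<in>(Basis :: 'a set). ?I)"
        by simp
      then show ?thesis
        by (simp add: prod.remove[OF finite_Basis b] del: prod_constant)
    qed
    ultimately show ?thesis
      by simp
  qed
  have "has_bochner_integral lborel
      (\<lambda>v::'a. (\<Sum>b\<in>Basis. (v \<bullet> b)\<^sup>2 * exp (- (a * (norm v)\<^sup>2 / 2))) / 2)
      ((\<Sum>b\<in>(Basis :: 'a set). ?I ^ DIM('a) / a) / 2)"
    by (intro has_bochner_integral_divide_zero has_bochner_integral_sum coord)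
  moreover have "(\<Sum>b\<in>Basis. (v \<bullet> b)\<^sup>2 * exp (- (a * (norm v)\<^sup>2 / 2))) / 2
      = (norm v)\<^sup>2 / 2 * exp (- (a * (norm v)\<^sup>2 / 2))" for v :: 'a
    unfolding euclidean_inner[of v v, folded power2_norm_eq_inner]
    by (simp add: power2_eq_square sum_distrib_right)
  ultimately show ?thesis
    by (simp add: mult.commute)
qed

text \<open>The unnormalised Maxwellian, that is, the classical profile with unit fugacity.\<close>

definition maxwellian :: "'a::euclidean_space \<Rightarrow> real" where
  "maxwellian v = exp (- (norm v)\<^sup>2 / 2)"

text \<open>The Gaussian integral \<open>(2 \<pi>)\<^bsup>n/2\<^esup>\<close> over an \<open>n\<close>-dimensional space; the dimension is
read off from the type.\<close>

definition partition_const :: "'a::euclidean_space itself \<Rightarrow> real" where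
  "partition_const _ = sqrt (2 * pi) ^ DIM('a)"

lemma maxwellian_bounds: "0 < maxwellian v" "maxwellian v \<le> 1"
  by (auto simp: maxwellian_def)

lemma measurable_maxwellian [measurable]: "maxwellian \<in> borel_measurable borel"
  unfolding maxwellian_def[abs_def] by measurable

lemma quantum_profile_maxwellian:
  "quantum_profile k c v = c * maxwellian v / (1 - k * c * maxwellian v)"
  by (simp add: quantum_profile_def maxwellian_def)

lemma measurable_quantum_profile [measurable]: "quantum_profile k c \<in> borel_measurable borel"
  unfolding quantum_profile_maxwellian[abs_def] by measurable

lemma maxwellian_square: "(maxwellian v)\<^sup>2 = exp (- (2 * (norm v)\<^sup>2 / 2))"
  by (simp add: maxwellian_def flip: exp_double)

lemma partition_const_pos: "0 < partition_const TYPE('a::euclidean_space)"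
  by (simp add: partition_const_def)

lemma maxwellian_moments:
  defines "Z \<equiv> partition_const TYPE('a::euclidean_space)"
    and "n \<equiv> real DIM('a)"
    and "q \<equiv> 1 / sqrt 2 ^ DIM('a)"
  shows "has_bochner_integral lborel (\<lambda>v::'a. maxwellian v) Z"
    and "has_bochner_integral lborel (\<lambda>v::'a. (maxwellian v)\<^sup>2) (Z * q)"
    and "has_bochner_integral lborel (\<lambda>v::'a. (norm v)\<^sup>2 / 2 * maxwellian v) (n / 2 * Z)"
    and "has_bochner_integral lborel (\<lambda>v::'a. (norm v)\<^sup>2 / 2 * (maxwellian v)\<^sup>2) (n / 4 * Z * q)"
proof -
  have Z: "Z * q = sqrt (2 * pi / 2) ^ DIM('a)"
    by (simp add: Z_def q_def partition_const_def real_sqrt_mult power_mult_distrib)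
  show "has_bochner_integral lborel (\<lambda>v::'a. maxwellian v) Z"
    using has_bochner_integral_gaussian[of 1, where 'a = 'a]
    by (simp add: maxwellian_def Z_def partition_const_def)
  show "has_bochner_integral lborel (\<lambda>v::'a. (maxwellian v)\<^sup>2) (Z * q)"
    using has_bochner_integral_gaussian[of 2, where 'a = 'a]
    unfolding Z maxwellian_square by simp
  show "has_bochner_integral lborel (\<lambda>v::'a. (norm v)\<^sup>2 / 2 * maxwellian v) (n / 2 * Z)"
    using has_bochner_integral_gaussian_energy[of 1, where 'a = 'a]
    by (simp add: maxwellian_def Z_def partition_const_def n_def)
  show "has_bochner_integral lborel (\<lambda>v::'a. (norm v)\<^sup>2 / 2 * (maxwellian v)\<^sup>2) (n / 4 * Z * q)"
    using has_bochner_integral_gaussian_energy[of 2, where 'a = 'a]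
    unfolding mult.assoc Z maxwellian_square by (simp add: n_def)
qed

section \<open>First-order expansion in the quantum parameter\<close>

lemma occupancy_bounds:
  assumes "\<bar>k * c\<bar> \<le> 1 / 2"
  shows "\<bar>k * c * maxwellian v\<bar> \<le> 1 / 2"
proof -
  have "\<bar>k * c\<bar> * maxwellian v \<le> 1 / 2 * 1"
    using assms maxwellian_bounds[of v] by (intro mult_mono) auto
  then show ?thesis
    using maxwellian_bounds(1)[of v] by (simp add: abs_mult)
qed

text \<open>As \<open>maxwellian v \<le> 1\<close>, the cubic error terms of the expansions are dominated by a multiple of
\<open>maxwellian v\<close> itself, so that no third-order moments are needed.\<close>

lemma cubic_term_bound:
  assumes "0 < c"
  shows "k\<^sup>2 * (c * maxwellian v) ^ 3 \<le> k\<^sup>2 * c ^ 3 * maxwellian v"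
proof -
  have "maxwellian v ^ 3 \<le> maxwellian v"
    using maxwellian_bounds[of v] power_decreasing[of 1 3 "maxwellian v"] by simp
  then show ?thesis
    using assms by (simp add: power_mult_distrib mult_left_mono mult.assoc)
qed

lemma quantum_profile_expansion:
  assumes c: "0 < c" and kc: "\<bar>k * c\<bar> \<le> 1 / 2"
  shows "\<bar>quantum_profile k c v - (c * maxwellian v + k * c\<^sup>2 * (maxwellian v)\<^sup>2)\<bar>
           \<le> 2 * k\<^sup>2 * c ^ 3 * maxwellian v"
proof -
  define x where "x = c * maxwellian v"
  have x: "0 < x" "\<bar>k * x\<bar> \<le> 1 / 2"
    using c maxwellian_bounds(1)[of v] occupancy_bounds[OF kc, of v]
    by (auto simp: x_def mult.assoc)
  then have d: "1 / 2 \<le> 1 - k * x"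
    by (auto simp: abs_le_iff)
  have "x / (1 - k * x) - (x + k * x\<^sup>2) = k\<^sup>2 * x ^ 3 / (1 - k * x)"
    using d by (simp add: field_simps power2_eq_square power3_eq_cube)
  then have "\<bar>x / (1 - k * x) - (x + k * x\<^sup>2)\<bar> = k\<^sup>2 * x ^ 3 / (1 - k * x)"
    using d x by simp
  also have "\<dots> \<le> k\<^sup>2 * x ^ 3 / (1 / 2)"
    using d x by (intro divide_left_mono) auto
  also have "\<dots> = 2 * (k\<^sup>2 * x ^ 3)"
    by simp
  also have "\<dots> \<le> 2 * (k\<^sup>2 * c ^ 3 * maxwellian v)"
    using cubic_term_bound[OF c, of k v] unfolding x_def by (intro mult_left_mono) auto
  finally show ?thesis
    unfolding quantum_profile_maxwellian x_def power_mult_distrib by (simp only: mult.assoc)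
qed

text \<open>The integrand by which the entropy of the quantum Maxwellian differs, up to multiples of its
mass, from its energy; it tends to \<open>c * maxwellian v\<close> as \<open>k\<close> tends to 0.\<close>

definition log_density :: "real \<Rightarrow> real \<Rightarrow> 'a::euclidean_space \<Rightarrow> real" where
  "log_density k c v = - ln (1 - k * c * maxwellian v) / k"

lemma measurable_log_density [measurable]: "log_density k c \<in> borel_measurable borel"
  unfolding log_density_def[abs_def] by measurable

lemma log_remainder_bound:
  fixes y :: real
  assumes "\<bar>y\<bar> \<le> 1 / 2"
  shows "\<bar>- ln (1 - y) - y - y\<^sup>2 / 2\<bar> \<le> 2 * \<bar>y\<bar> ^ 3"
proof -
  have "norm ((- ln (1 - y) - y - y\<^sup>2 / 2) - (- ln (1 - 0) - 0 - 0\<^sup>2 / 2)) \<le> 2 * \<bar>y\<bar>\<^sup>2 * norm (y - 0)"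
  proof (rule field_differentiable_bound[of "{- \<bar>y\<bar>..\<bar>y\<bar>}"])
    fix z assume "z \<in> {- \<bar>y\<bar>..\<bar>y\<bar>}"
    then have z: "\<bar>z\<bar> \<le> \<bar>y\<bar>" "1 / 2 \<le> 1 - z"
      using assms by auto
    show "((\<lambda>y. - ln (1 - y) - y - y\<^sup>2 / 2) has_field_derivative z\<^sup>2 / (1 - z))
            (at z within {- \<bar>y\<bar>..\<bar>y\<bar>})"
      using z by (auto intro!: derivative_eq_intros simp: field_simps power2_eq_square)
    have "z\<^sup>2 / (1 - z) \<le> \<bar>y\<bar>\<^sup>2 / (1 / 2)"
      using z by (intro frac_le) (auto simp: abs_le_square_iff)
    then show "norm (z\<^sup>2 / (1 - z)) \<le> 2 * \<bar>y\<bar>\<^sup>2"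
      using z by (simp add: abs_of_nonneg)
  qed auto
  then show ?thesis
    by (simp add: power3_eq_cube power2_eq_square mult.assoc)
qed


lemma log_density_expansion:
  assumes c: "0 < c" and kc: "\<bar>k * c\<bar> \<le> 1 / 2" and k: "k \<noteq> 0"
  shows "\<bar>log_density k c v - (c * maxwellian v + k * c\<^sup>2 / 2 * (maxwellian v)\<^sup>2)\<bar>
           \<le> 2 * k\<^sup>2 * c ^ 3 * maxwellian v"
proof -
  define x where "x = c * maxwellian v"
  have x: "0 < x" "\<bar>k * x\<bar> \<le> 1 / 2"
    using c maxwellian_bounds(1)[of v] occupancy_bounds[OF kc, of v]
    by (auto simp: x_def mult.assoc)
  have "- ln (1 - k * x) / k - (x + k / 2 * x\<^sup>2) = (- ln (1 - k * x) - k * x - (k * x)\<^sup>2 / 2) / k"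
    using k by (simp add: field_simps power2_eq_square)
  then have "\<bar>- ln (1 - k * x) / k - (x + k / 2 * x\<^sup>2)\<bar>
      = \<bar>- ln (1 - k * x) - k * x - (k * x)\<^sup>2 / 2\<bar> / \<bar>k\<bar>"
    by simp
  also have "\<dots> \<le> 2 * \<bar>k * x\<bar> ^ 3 / \<bar>k\<bar>"
    using log_remainder_bound[OF x(2)] by (intro divide_right_mono) auto
  also have "\<dots> = 2 * (k\<^sup>2 * x ^ 3)"
    using k x(1) by (simp add: abs_mult power3_eq_cube power2_eq_square field_simps)
  also have "\<dots> \<le> 2 * (k\<^sup>2 * c ^ 3 * maxwellian v)"
    using cubic_term_bound[OF c, of k v] unfolding x_def by (intro mult_left_mono) auto
  finally show ?thesis
    unfolding log_density_def x_def power_mult_distrib times_divide_eq_left times_divide_eq_right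
    by (simp only: mult.assoc)
qed

text \<open>A pointwise expansion in powers of the Maxwellian integrates to an expansion of the moments. The
weights of interest are \<open>1\<close> (mass) and \<open>|v|\<^sup>2 / 2\<close> (energy).\<close>

lemma weighted_integral_expansion:
  fixes f w :: "'a::euclidean_space \<Rightarrow> real"
  assumes [measurable]: "f \<in> borel_measurable borel" "w \<in> borel_measurable borel"
    and w: "\<And>v. 0 \<le> w v"
    and I1: "has_bochner_integral lborel (\<lambda>v. w v * maxwellian v) I\<^sub>1"
    and I2: "has_bochner_integral lborel (\<lambda>v. w v * (maxwellian v)\<^sup>2) I\<^sub>2"
    and f: "\<And>v. \<bar>f v - (\<alpha> * maxwellian v + \<beta> * (maxwellian v)\<^sup>2)\<bar> \<le> r * maxwellian v"
  shows "integrable lborel (\<lambda>v. w v * f v)"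
    and "\<bar>(LINT v|lborel. w v * f v) - (\<alpha> * I\<^sub>1 + \<beta> * I\<^sub>2)\<bar> \<le> r * I\<^sub>1"
proof -
  let ?h = "\<lambda>v. \<alpha> * (w v * maxwellian v) + \<beta> * (w v * (maxwellian v)\<^sup>2)"
  have h: "has_bochner_integral lborel ?h (\<alpha> * I\<^sub>1 + \<beta> * I\<^sub>2)"
    by (intro has_bochner_integral_add has_bochner_integral_mult_right I1 I2)
  have r: "has_bochner_integral lborel (\<lambda>v. r * (w v * maxwellian v)) (r * I\<^sub>1)"
    by (intro has_bochner_integral_mult_right I1)
  have le: "\<bar>w v * f v - ?h v\<bar> \<le> r * (w v * maxwellian v)" for v
  proof -
    have "\<bar>w v * f v - ?h v\<bar> = w v * \<bar>f v - (\<alpha> * maxwellian v + \<beta> * (maxwellian v)\<^sup>2)\<bar>"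
    proof -
      have "w v * f v - ?h v = w v * (f v - (\<alpha> * maxwellian v + \<beta> * (maxwellian v)\<^sup>2))"
        by (simp add: algebra_simps)
      then show ?thesis
        using w[of v] by (simp only: abs_mult abs_of_nonneg)
    qed
    also have "\<dots> \<le> w v * (r * maxwellian v)"
      using w f by (intro mult_left_mono)
    finally show ?thesis
      by (simp add: mult_ac)
  qed
  have diff: "integrable lborel (\<lambda>v. w v * f v - ?h v)"
  proof (rule Bochner_Integration.integrable_bound)
    show "integrable lborel (\<lambda>v. r * (w v * maxwellian v))"
      using r by (simp only: has_bochner_integral_iff)
    show "(\<lambda>v. w v * f v - ?h v) \<in> borel_measurable lborel"
      by measurable
    show "AE v in lborel. norm (w v * f v - ?h v) \<le> norm (r * (w v * maxwellian v))"
      using order_trans[OF le abs_ge_self] by (intro AE_I2) (simp only: real_norm_def)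
  qed
  show int: "integrable lborel (\<lambda>v. w v * f v)"
    using Bochner_Integration.integrable_add[OF diff integrable.intros[OF h]]
    by (simp only: diff_add_cancel)
  have "(LINT v|lborel. w v * f v) - (\<alpha> * I\<^sub>1 + \<beta> * I\<^sub>2) = (LINT v|lborel. w v * f v - ?h v)"
    using h by (simp only: has_bochner_integral_iff Bochner_Integration.integral_diff[OF int])
  also have "\<bar>\<dots>\<bar> \<le> (LINT v|lborel. \<bar>w v * f v - ?h v\<bar>)"
    by (rule integral_abs_bound)
  also have "\<dots> \<le> (LINT v|lborel. r * (w v * maxwellian v))"
    using r le by (intro integral_mono integrable_abs[OF diff]) (simp_all only: has_bochner_integral_iff)
  also have "\<dots> = r * I\<^sub>1"
    using r by (simp only: has_bochner_integral_iff)
  finally show "\<bar>(LINT v|lborel. w v * f v) - (\<alpha> * I\<^sub>1 + \<beta> * I\<^sub>2)\<bar> \<le> r * I\<^sub>1" .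
qed

corollary integral_expansion:
  fixes f :: "'a::euclidean_space \<Rightarrow> real"
  defines "Z \<equiv> partition_const TYPE('a)"
    and "q \<equiv> 1 / sqrt 2 ^ DIM('a)"
  assumes "f \<in> borel_measurable borel"
    and "\<And>v. \<bar>f v - (\<alpha> * maxwellian v + \<beta> * (maxwellian v)\<^sup>2)\<bar> \<le> r * maxwellian v"
  shows "integrable lborel f"
    and "\<bar>(LINT v|lborel. f v) - Z * (\<alpha> + q * \<beta>)\<bar> \<le> r * Z"
proof -
  note * = weighted_integral_expansion[OF assms(3), of "\<lambda>_. 1" Z "Z * q" \<alpha> \<beta> r]
  show "integrable lborel f"
    using *(1) maxwellian_moments(1,2)[where 'a = 'a] assms by simp
  show "\<bar>(LINT v|lborel. f v) - Z * (\<alpha> + q * \<beta>)\<bar> \<le> r * Z"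
    using *(2) maxwellian_moments(1,2)[where 'a = 'a] assms by (simp add: algebra_simps)
qed

context
  fixes k c :: real
  assumes c: "0 < c" and kc: "\<bar>k * c\<bar> \<le> 1 / 2"
begin

lemma mass_expansion:
  defines "Z \<equiv> partition_const TYPE('a::euclidean_space)"
    and "q \<equiv> 1 / sqrt 2 ^ DIM('a)"
  shows "integrable lborel (quantum_profile k c :: 'a \<Rightarrow> real)"
    and "\<bar>(LINT v|lborel. quantum_profile k c (v::'a)) - Z * (c + q * k * c\<^sup>2)\<bar>
           \<le> 2 * k\<^sup>2 * c ^ 3 * Z"
  using integral_expansion[OF measurable_quantum_profile quantum_profile_expansion[OF c kc], where 'a = 'a]
  by (simp_all add: Z_def q_def mult_ac)

lemma energy_expansion:
  defines "Z \<equiv> partition_const TYPE('a::euclidean_space)"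
    and "n \<equiv> real DIM('a)"
    and "q \<equiv> 1 / sqrt 2 ^ DIM('a)"
  shows "integrable lborel (\<lambda>v::'a. (norm v)\<^sup>2 / 2 * quantum_profile k c v)"
    and "\<bar>(LINT v|lborel. (norm (v::'a))\<^sup>2 / 2 * quantum_profile k c v)
            - n / 2 * Z * (c + q / 2 * k * c\<^sup>2)\<bar> \<le> n * k\<^sup>2 * c ^ 3 * Z"
proof -
  note * = weighted_integral_expansion[of "quantum_profile k c :: 'a \<Rightarrow> real" "\<lambda>v. (norm v)\<^sup>2 / 2",
      OF _ _ _ maxwellian_moments(3,4) quantum_profile_expansion[OF c kc]]
  show "integrable lborel (\<lambda>v::'a. (norm v)\<^sup>2 / 2 * quantum_profile k c v)"
    by (rule *) auto
  show "\<bar>(LINT v|lborel. (norm (v::'a))\<^sup>2 / 2 * quantum_profile k c v)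
            - n / 2 * Z * (c + q / 2 * k * c\<^sup>2)\<bar> \<le> n * k\<^sup>2 * c ^ 3 * Z"
    using *(2) by (simp add: Z_def n_def q_def algebra_simps)
qed

lemma log_expansion:
  defines "Z \<equiv> partition_const TYPE('a::euclidean_space)"
    and "q \<equiv> 1 / sqrt 2 ^ DIM('a)"
  assumes k: "k \<noteq> 0"
  shows "integrable lborel (log_density k c :: 'a \<Rightarrow> real)"
    and "\<bar>(LINT v|lborel. log_density k c (v::'a)) - Z * (c + q / 2 * k * c\<^sup>2)\<bar>
           \<le> 2 * k\<^sup>2 * c ^ 3 * Z"
  using integral_expansion[OF measurable_log_density log_density_expansion[OF c kc k], where 'a = 'a]
  by (simp_all add: Z_def q_def mult_ac)

end

section \<open>Existence and uniqueness of the normalising constant\<close>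

text \<open>Without smallness of \<open>k * c\<close>, the denominator of the profile is still bounded away from 0 as
soon as \<open>k * c < 1\<close>. This is the range in which uniqueness has to be shown.\<close>

lemma occupancy_le:
  assumes "0 < c" "k * c < 1"
  shows "0 < min 1 (1 - k * c)" "min 1 (1 - k * c) \<le> 1 - k * c * maxwellian v"
proof -
  show "0 < min 1 (1 - k * c)"
    using assms by simp
  show "min 1 (1 - k * c) \<le> 1 - k * c * maxwellian v"
  proof (cases "k \<ge> 0")
    case True
    then have "k * c * maxwellian v \<le> k * c * 1"
      using assms maxwellian_bounds[of v] by (intro mult_left_mono) auto
    then show ?thesis by simp
  next
    case False
    then have "k * c * maxwellian v \<le> 0"
      using assms maxwellian_bounds[of v] by (simp add: mult_le_0_iff)
    then show ?thesis by simp
  qed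
qed

lemma occupancy_pos:
  assumes "0 < c" "k * c < 1"
  shows "0 < 1 - k * c * maxwellian v"
  using occupancy_le[OF assms] by (rule less_le_trans)

lemma integrable_quantum_profile:
  assumes "0 < c" "k * c < 1"
  shows "integrable lborel (quantum_profile k c :: 'a::euclidean_space \<Rightarrow> real)"
proof (rule Bochner_Integration.integrable_bound)
  let ?m = "min 1 (1 - k * c)"
  show "integrable lborel (\<lambda>v::'a. c / ?m * maxwellian v)"
    using maxwellian_moments(1)[where 'a = 'a] by (auto simp: has_bochner_integral_iff)
  have "norm (quantum_profile k c v) \<le> norm (c / ?m * maxwellian v)" for v :: 'a
  proof -
    note m = occupancy_le(1)[OF assms] occupancy_le(2)[OF assms, of v] occupancy_pos[OF assms, of v]
    have "c * maxwellian v / (1 - k * c * maxwellian v) \<le> c * maxwellian v / ?m"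
      using m assms maxwellian_bounds(1)[of v] by (intro divide_left_mono) auto
    moreover have "0 \<le> c * maxwellian v / (1 - k * c * maxwellian v)"
      using m assms maxwellian_bounds(1)[of v] by (intro divide_nonneg_nonneg) auto
    ultimately show ?thesis
      unfolding quantum_profile_maxwellian real_norm_def
      using order_trans[OF _ abs_ge_self] by (simp only: abs_of_nonneg times_divide_eq_left)
  qed
  then show "AE v::'a in lborel. norm (quantum_profile k c v) \<le> norm (c / ?m * maxwellian v)"
    by simp
qed simp

lemma quantum_profile_diff:
  assumes "0 < c" "k * c < 1" "0 < d" "k * d < 1"
  shows "quantum_profile k d v - quantum_profile k c v
           = (d - c) * maxwellian v / ((1 - k * c * maxwellian v) * (1 - k * d * maxwellian v))"
proof -
  have "1 - k * c * maxwellian v \<noteq> 0" "1 - k * d * maxwellian v \<noteq> 0"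
    using occupancy_pos[OF assms(1,2), of v] occupancy_pos[OF assms(3,4), of v] by linarith+
  then show ?thesis
    unfolding quantum_profile_maxwellian by (simp add: diff_frac_eq algebra_simps)
qed

lemma mass_strict_mono:
  assumes c: "0 < c" "k * c < 1" and d: "c < d" "k * d < 1"
  shows "(LINT v|lborel. quantum_profile k c (v::'a::euclidean_space))
           < (LINT v|lborel. quantum_profile k d (v::'a))"
proof -
  have d0: "0 < d" using c d by simp
  let ?B = "(1 + \<bar>k\<bar> * c) * (1 + \<bar>k\<bar> * d)"
  define \<delta> where "\<delta> = (d - c) / ?B"
  have B: "0 < ?B"
    using c d0 by (intro mult_pos_pos add_pos_nonneg) auto
  have \<delta>: "0 < \<delta>"
    using B d by (simp add: \<delta>_def)
  have upper: "1 - k * e * maxwellian v \<le> 1 + \<bar>k\<bar> * e" if "0 < e" for e and v :: 'a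
  proof -
    have "- k * e * maxwellian v \<le> \<bar>k\<bar> * e * 1"
      using that maxwellian_bounds[of v] by (intro mult_mono) auto
    then show ?thesis by simp
  qed
  \<comment> \<open>A pointwise gap proportional to the Maxwellian makes the inequality of the integrals strict.\<close>
  have "\<delta> * maxwellian v \<le> quantum_profile k d v - quantum_profile k c v" for v :: 'a
  proof -
    note pos = occupancy_pos[OF c, of v] occupancy_pos[OF d0 d(2), of v]
    have "(d - c) * maxwellian v / ?B
        \<le> (d - c) * maxwellian v / ((1 - k * c * maxwellian v) * (1 - k * d * maxwellian v))"
      using pos d maxwellian_bounds(1)[of v] c(1) d0 B
      by (intro divide_left_mono mult_mono upper mult_pos_pos mult_nonneg_nonneg)
         (auto intro: add_pos_nonneg)
    then show ?thesis
      by (simp add: quantum_profile_diff[OF c d0 d(2)] \<delta>_def)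
  qed
  then have "(LINT v|lborel. \<delta> * maxwellian (v::'a))
      \<le> (LINT v|lborel. quantum_profile k d (v::'a) - quantum_profile k c v)"
    using maxwellian_moments(1)[where 'a = 'a]
    by (intro integral_mono Bochner_Integration.integrable_diff integrable_quantum_profile c d d0)
       (auto simp: has_bochner_integral_iff)
  also have "\<dots> = (LINT v|lborel. quantum_profile k d (v::'a)) - (LINT v|lborel. quantum_profile k c (v::'a))"
    by (intro Bochner_Integration.integral_diff integrable_quantum_profile c d d0)
  finally have "\<delta> * partition_const TYPE('a)
      \<le> (LINT v|lborel. quantum_profile k d (v::'a)) - (LINT v|lborel. quantum_profile k c (v::'a))"
    using maxwellian_moments(1)[where 'a = 'a] by (simp add: has_bochner_integral_iff)
  moreover have "0 < \<delta> * partition_const TYPE('a)"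
    using \<delta> by (intro mult_pos_pos partition_const_pos)
  ultimately show ?thesis by linarith
qed

lemma mass_continuous:
  assumes "0 < a" "\<bar>k\<bar> * b \<le> 1 / 2"
  shows "continuous_on {a..b} (\<lambda>c. LINT v|lborel. quantum_profile k c (v::'a::euclidean_space))"
proof -
  define Z where "Z = partition_const TYPE('a)"
  have small: "0 < c" "\<bar>k * c\<bar> \<le> 1 / 2" "k * c < 1" if "c \<in> {a..b}" for c
  proof -
    show "0 < c" using that assms by simp
    have "\<bar>k\<bar> * c \<le> \<bar>k\<bar> * b"
      using that by (intro mult_left_mono) auto
    then show "\<bar>k * c\<bar> \<le> 1 / 2"
      using assms \<open>0 < c\<close> by (simp add: abs_mult)
    then show "k * c < 1" by (auto simp: abs_le_iff)
  qed
  \<comment> \<open>Both denominators are at least 1/2, whence the factor 4.\<close>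
  have "(4 * Z)-lipschitz_on {a..b} (\<lambda>c. LINT v|lborel. quantum_profile k c (v::'a))"
  proof (rule lipschitz_onI)
    fix c d assume cd: "c \<in> {a..b}" "d \<in> {a..b}"
    note c = small[OF cd(1)] and d = small[OF cd(2)]
    have "norm (quantum_profile k c v - quantum_profile k d v) \<le> 4 * \<bar>c - d\<bar> * maxwellian v" for v :: 'a
    proof -
      have occ: "1 / 2 \<le> 1 - k * c * maxwellian v" "1 / 2 \<le> 1 - k * d * maxwellian v"
        using occupancy_bounds[OF c(2), of v] occupancy_bounds[OF d(2), of v] by (auto simp: abs_le_iff)
      then have "1 / 2 * (1 / 2) \<le> (1 - k * d * maxwellian v) * (1 - k * c * maxwellian v)"
        by (intro mult_mono) auto
      then have "\<bar>c - d\<bar> * maxwellian v / ((1 - k * d * maxwellian v) * (1 - k * c * maxwellian v))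
          \<le> \<bar>c - d\<bar> * maxwellian v / (1 / 2 * (1 / 2))"
        using occ maxwellian_bounds(1)[of v] by (intro divide_left_mono) auto
      then show ?thesis
        using occ maxwellian_bounds(1)[of v]
        unfolding quantum_profile_diff[OF d(1,3) c(1,3)] by (simp add: abs_mult)
    qed
    note le = this
    have "norm (LINT v|lborel. quantum_profile k c (v::'a) - quantum_profile k d v)
        \<le> (LINT v|lborel. norm (quantum_profile k c (v::'a) - quantum_profile k d v))"
      by (rule integral_norm_bound)
    also have "\<dots> \<le> (LINT v|lborel. 4 * \<bar>c - d\<bar> * maxwellian (v::'a))"
      using le c d maxwellian_moments(1)[where 'a = 'a]
      by (intro integral_mono integrable_norm Bochner_Integration.integrable_diff
          integrable_quantum_profile) (auto simp: has_bochner_integral_iff)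
    also have "\<dots> = 4 * \<bar>c - d\<bar> * Z"
      using maxwellian_moments(1)[where 'a = 'a] by (simp add: has_bochner_integral_iff Z_def)
    finally show "dist (LINT v|lborel. quantum_profile k c (v::'a)) (LINT v|lborel. quantum_profile k d (v::'a))
        \<le> 4 * Z * dist c d"
      using c d by (simp add: dist_real_def integrable_quantum_profile mult_ac)
  qed (use partition_const_pos[where 'a = 'a] in \<open>simp add: Z_def\<close>)
  then show ?thesis
    by (rule lipschitz_on_continuous_on)
qed

text \<open>The constant \<open>C\<^sub>0\<close> is the classical normalising constant. Since \<open>|k c| \<le> 1/2\<close> on
\<open>[C\<^sub>0/2, 2 C\<^sub>0]\<close>, the profile there is at most \<open>2 c g\<close> and at least \<open>2 c g / 3\<close>, where \<open>g\<close> is the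
Maxwellian; so the prescribed mass lies between the masses at the two endpoints.\<close>

lemma normalising_const_range_and_mass:
  fixes \<Omega> :: "'a::euclidean_space set" and \<rho> :: real
  defines "C\<^sub>0 \<equiv> \<rho> / (measure lborel \<Omega> * partition_const TYPE('a))"
  assumes vol: "0 < measure lborel \<Omega>" and \<rho>: "0 < \<rho>" and k: "\<bar>k\<bar> * (2 * C\<^sub>0) \<le> 1 / 2"
  shows "normalising_const \<Omega> \<rho> k \<in> {C\<^sub>0 / 2..2 * C\<^sub>0}"
    and "measure lborel \<Omega> * (LINT v|lborel. quantum_profile k (normalising_const \<Omega> \<rho> k) (v::'a)) = \<rho>"
proof -
  define Z where "Z = partition_const TYPE('a)"
  define I where "I c = (LINT v|lborel. quantum_profile k c (v::'a))" for c
  have Z: "0 < Z" by (simp add: Z_def partition_const_pos)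
  have C0: "0 < C\<^sub>0" using vol \<rho> Z by (simp add: C\<^sub>0_def Z_def)
  have \<rho>_eq: "\<rho> = measure lborel \<Omega> * (C\<^sub>0 * Z)"
    using vol Z by (simp add: C\<^sub>0_def Z_def)
  have int: "(LINT v|lborel. a * maxwellian (v::'a)) = a * Z" for a
    using maxwellian_moments(1)[where 'a = 'a] by (simp add: has_bochner_integral_iff Z_def)
  have small: "\<bar>k * c\<bar> \<le> 1 / 2" if "c \<in> {C\<^sub>0 / 2..2 * C\<^sub>0}" for c
  proof -
    have "\<bar>k\<bar> * \<bar>c\<bar> \<le> \<bar>k\<bar> * (2 * C\<^sub>0)"
      using that C0 by (intro mult_left_mono) auto
    then show ?thesis using k by (simp add: abs_mult)
  qed
  have lower: "I (C\<^sub>0 / 2) \<le> C\<^sub>0 * Z"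
  proof -
    have kc: "\<bar>k * (C\<^sub>0 / 2)\<bar> \<le> 1 / 2" using C0 by (intro small) simp
    have "quantum_profile k (C\<^sub>0 / 2) v \<le> C\<^sub>0 * maxwellian v" for v :: 'a
    proof -
      have occ: "1 / 2 \<le> 1 - k * (C\<^sub>0 / 2) * maxwellian v"
        using occupancy_bounds[OF kc, of v] by (auto simp: abs_le_iff)
      then have "C\<^sub>0 / 2 * maxwellian v / (1 - k * (C\<^sub>0 / 2) * maxwellian v)
          \<le> C\<^sub>0 / 2 * maxwellian v / (1 / 2)"
        using C0 maxwellian_bounds(1)[of v] by (intro divide_left_mono) auto
      then show ?thesis unfolding quantum_profile_maxwellian by simp
    qed
    then have "I (C\<^sub>0 / 2) \<le> (LINT v|lborel. C\<^sub>0 * maxwellian (v::'a))"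
      unfolding I_def using C0 kc maxwellian_moments(1)[where 'a = 'a]
      by (intro integral_mono mass_expansion(1)) (auto simp: has_bochner_integral_iff)
    then show ?thesis by (simp only: int)
  qed
  have upper: "C\<^sub>0 * Z \<le> I (2 * C\<^sub>0)"
  proof -
    have kc: "\<bar>k * (2 * C\<^sub>0)\<bar> \<le> 1 / 2" using C0 by (intro small) simp
    have "C\<^sub>0 * maxwellian v \<le> quantum_profile k (2 * C\<^sub>0) v" for v :: 'a
    proof -
      have occ: "1 - k * (2 * C\<^sub>0) * maxwellian v \<le> 2" "0 < 1 - k * (2 * C\<^sub>0) * maxwellian v"
        using occupancy_bounds[OF kc, of v] by (simp_all only: abs_le_iff) linarith+
      then have "2 * C\<^sub>0 * maxwellian v / 2
          \<le> 2 * C\<^sub>0 * maxwellian v / (1 - k * (2 * C\<^sub>0) * maxwellian v)"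
        using C0 maxwellian_bounds(1)[of v] by (intro divide_left_mono mult_pos_pos) simp_all
      then show ?thesis unfolding quantum_profile_maxwellian by simp
    qed
    then have "(LINT v|lborel. C\<^sub>0 * maxwellian (v::'a)) \<le> I (2 * C\<^sub>0)"
      unfolding I_def using C0 kc maxwellian_moments(1)[where 'a = 'a]
      by (intro integral_mono mass_expansion(1)) (auto simp: has_bochner_integral_iff)
    then show ?thesis by (simp only: int)
  qed
  have "continuous_on {C\<^sub>0 / 2..2 * C\<^sub>0} I"
    unfolding I_def using C0 k by (intro mass_continuous) auto
  then obtain c where c: "c \<in> {C\<^sub>0 / 2..2 * C\<^sub>0}" "I c = C\<^sub>0 * Z"
    using IVT'[of I "C\<^sub>0 / 2" "C\<^sub>0 * Z" "2 * C\<^sub>0"] lower upper C0 by auto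
  have c': "0 < c" "k * c < 1" "measure lborel \<Omega> * I c = \<rho>"
    using c C0 small[OF c(1)] by (auto simp: \<rho>_eq abs_le_iff)
  have "normalising_const \<Omega> \<rho> k = c"
    unfolding normalising_const_def
  proof (rule the_equality)
    show "0 < c \<and> k * c < 1 \<and> measure lborel \<Omega> * (LINT v|lborel. quantum_profile k c (v::'a)) = \<rho>"
      using c' by (simp add: I_def)
    fix d assume d: "0 < d \<and> k * d < 1 \<and>
        measure lborel \<Omega> * (LINT v|lborel. quantum_profile k d (v::'a)) = \<rho>"
    then have "I d = I c"
      using c' vol unfolding I_def by (metis less_irrefl mult_cancel_left)
    then show "d = c"
      using mass_strict_mono[of c k d, where 'a = 'a] mass_strict_mono[of d k c, where 'a = 'a] c' d
      unfolding I_def by (cases c d rule: linorder_cases) auto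
  qed
  then show "normalising_const \<Omega> \<rho> k \<in> {C\<^sub>0 / 2..2 * C\<^sub>0}"
    and "measure lborel \<Omega> * (LINT v|lborel. quantum_profile k (normalising_const \<Omega> \<rho> k) (v::'a)) = \<rho>"
    using c c' by (auto simp: I_def)
qed


section \<open>Energy and entropy of the quantum Maxwellian\<close>

lemma bounded_domain_measure:
  assumes "bounded_domain \<Omega>"
  shows "\<Omega> \<in> sets lborel" "emeasure lborel \<Omega> \<noteq> \<infinity>" "0 < measure lborel \<Omega>"
proof -
  show "\<Omega> \<in> sets lborel"
    using assms by (auto simp: bounded_domain_def)
  show fin: "emeasure lborel \<Omega> \<noteq> \<infinity>"
    using assms emeasure_bounded_finite[of \<Omega>] by (auto simp: bounded_domain_def)
  have "\<not> negligible \<Omega>"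
    using assms open_not_negligible[of \<Omega>] by (auto simp: bounded_domain_def)
  then have "emeasure lborel \<Omega> \<noteq> 0"
    using \<open>\<Omega> \<in> sets lborel\<close> by (auto simp: negligible_iff_null_sets null_sets_def)
  then show "0 < measure lborel \<Omega>"
    using fin by (simp add: measure_def enn2real_positive_iff top.not_eq_extremum zero_less_iff_neq_zero)
qed

text \<open>The quantum Maxwellian does not depend on the position, so that the outer integral only
contributes the volume.\<close>

lemma energy_homogeneous:
  assumes "bounded_domain \<Omega>"
  shows "energy \<Omega> (\<lambda>x. f) = measure lborel \<Omega> * (LINT v|lborel. (norm v)\<^sup>2 / 2 * f v)"
  using bounded_domain_measure[OF assms] by (simp add: energy_def set_integral_const)

lemma entropy_homogeneous:
  assumes "bounded_domain \<Omega>"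
  shows "entropy \<Omega> k (\<lambda>x. f) = - measure lborel \<Omega> * (LINT v|lborel. entropy_density k (f v))"
  using bounded_domain_measure[OF assms] by (simp add: entropy_def set_integral_const)

lemma ln_maxwellian: "ln (maxwellian v) = - (norm v)\<^sup>2 / 2"
  by (simp add: maxwellian_def)

lemma entropy_density_classical:
  assumes "0 < c"
  shows "entropy_density 0 (quantum_profile 0 c v)
           = ln c * quantum_profile 0 c v - (norm v)\<^sup>2 / 2 * quantum_profile 0 c v"
  using assms maxwellian_bounds(1)[of v]
  by (simp add: entropy_density_def quantum_profile_maxwellian ln_mult ln_maxwellian algebra_simps)

lemma entropy_density_quantum:
  assumes c: "0 < c" and kc: "k * c < 1" and k: "k \<noteq> 0"
  shows "entropy_density k (quantum_profile k c v)
           = ln c * quantum_profile k c v - (norm v)\<^sup>2 / 2 * quantum_profile k c v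
             + quantum_profile k c v - log_density k c v"
proof -
  define f where "f = quantum_profile k c v"
  define x where "x = c * maxwellian v"
  define d where "d = 1 - k * c * maxwellian v"
  have x: "0 < x" using c maxwellian_bounds(1)[of v] by (simp add: x_def)
  have d: "0 < d" using occupancy_pos[OF c kc, of v] by (simp add: d_def)
  have f: "f = x / d" by (simp add: f_def quantum_profile_maxwellian x_def d_def)
  have occ: "1 + k * f = 1 / d"
    using d by (simp add: f x_def d_def field_simps)
  have ln_f: "ln f = ln c - (norm v)\<^sup>2 / 2 - ln d"
    using x d c maxwellian_bounds(1)[of v] by (simp add: f ln_div) (simp add: x_def ln_mult ln_maxwellian)
  have inv: "1 / d = 1 + k * f" by (simp add: occ)
  have "entropy_density k f = f * ln f + (1 / k) * (1 / d) * ln d + f"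
    using d k by (simp add: entropy_density_def occ ln_div)
  also have "\<dots> = f * ln f + f * ln d + ln d / k + f"
    unfolding inv using k by (simp add: field_simps)
  also have "\<dots> = ln c * f - (norm v)\<^sup>2 / 2 * f + f - (- ln d / k)"
    unfolding ln_f by (simp add: algebra_simps)
  finally show ?thesis
    by (simp add: f_def d_def log_density_def)
qed

lemma entropy_classical:
  fixes \<Omega> :: "'a::euclidean_space set"
  assumes \<Omega>: "bounded_domain \<Omega>" and c: "0 < c"
  shows "entropy \<Omega> 0 (\<lambda>x. quantum_profile 0 c)
           = - (measure lborel \<Omega> * (LINT v|lborel. quantum_profile 0 c (v::'a))) * ln c
             + energy \<Omega> (\<lambda>x. quantum_profile 0 c)"
  using mass_expansion(1)[of c 0, where 'a = 'a] energy_expansion(1)[of c 0, where 'a = 'a] c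
  by (simp add: entropy_homogeneous[OF \<Omega>] energy_homogeneous[OF \<Omega>] entropy_density_classical
      algebra_simps)

lemma entropy_quantum:
  fixes \<Omega> :: "'a::euclidean_space set"
  assumes \<Omega>: "bounded_domain \<Omega>" and c: "0 < c" and kc: "\<bar>k * c\<bar> \<le> 1 / 2" and k: "k \<noteq> 0"
  defines "m \<equiv> measure lborel \<Omega> * (LINT v|lborel. quantum_profile k c (v::'a))"
  shows "entropy \<Omega> k (\<lambda>x. quantum_profile k c)
           = - m * ln c + energy \<Omega> (\<lambda>x. quantum_profile k c) - m
             + measure lborel \<Omega> * (LINT v|lborel. log_density k c (v::'a))"
proof -
  have kc': "k * c < 1" using kc by (auto simp: abs_le_iff)
  note int = mass_expansion(1)[OF c kc, where 'a = 'a] energy_expansion(1)[OF c kc, where 'a = 'a]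
    log_expansion(1)[OF c kc k, where 'a = 'a]
  have "(LINT v|lborel. entropy_density k (quantum_profile k c (v::'a)))
      = ln c * (LINT v|lborel. quantum_profile k c (v::'a))
        - (LINT v|lborel. (norm (v::'a))\<^sup>2 / 2 * quantum_profile k c v)
        + (LINT v|lborel. quantum_profile k c (v::'a)) - (LINT v|lborel. log_density k c (v::'a))"
    unfolding entropy_density_quantum[OF c kc' k] using int
    by (simp del: times_divide_eq_left)
  then show ?thesis
    unfolding entropy_homogeneous[OF \<Omega>] energy_homogeneous[OF \<Omega>] m_def
    by (simp only:) (simp only: algebra_simps)
qed

section \<open>Asymptotics as the quantum parameter vanishes\<close>

text \<open>Inverting the mass constraint \<open>C + q k C\<^sup>2 = a + O(k\<^sup>2)\<close>: it gives \<open>C = a + O(k)\<close>, hence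
\<open>k C\<^sup>2 = k a\<^sup>2 + O(k\<^sup>2)\<close>. The first conclusion is the combination occurring in the energy and in
the integrated logarithm.\<close>

lemma fugacity_asymptotics:
  fixes C :: "real \<Rightarrow> real"
  assumes a: "0 < a"
    and range: "\<forall>\<^sub>F k in at 0. C k \<in> {a / 2..2 * a}"
    and mass: "(\<lambda>k. C k + q * k * (C k)\<^sup>2 - a) \<in> O[at 0](\<lambda>k. k\<^sup>2)"
  shows "(\<lambda>k. C k + q / 2 * k * (C k)\<^sup>2 - a + q / 2 * k * a\<^sup>2) \<in> O[at 0](\<lambda>k. k\<^sup>2)"
    and "(\<lambda>k. ln (C k) - ln a + q * k * a) \<in> O[at 0](\<lambda>k. k\<^sup>2)"
proof -
  have id: "(\<lambda>k::real. k) \<in> O[at 0](\<lambda>k. k)" by simp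
  have square: "(\<lambda>k::real. k\<^sup>2) \<in> O[at 0](\<lambda>k. k)"
  proof (rule bigoI[of _ 1])
    have "norm (k\<^sup>2) \<le> 1 * norm k" if "\<bar>k\<bar> < 1" for k :: real
      using mult_left_le[of "\<bar>k\<bar>" "\<bar>k\<bar>"] that by (simp add: power2_eq_square)
    then show "\<forall>\<^sub>F k::real in at 0. norm (k\<^sup>2) \<le> 1 * norm k"
      unfolding eventually_at by (intro exI[of _ 1]) auto
  qed
  have C: "C \<in> O[at 0](\<lambda>_. 1)"
    using range by (intro bigoI[of _ "2 * a"]) (auto elim!: eventually_mono simp: a less_imp_le)
  have C2: "(\<lambda>k. (C k)\<^sup>2) \<in> O[at 0](\<lambda>_. 1)"
    using landau_o.big.mult[OF C C] by (simp add: power2_eq_square)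
  have kC2: "(\<lambda>k. k * (C k)\<^sup>2) \<in> O[at 0](\<lambda>k. k)"
    using landau_o.big.mult[OF id C2] by simp
  have diff: "(\<lambda>k. C k - a) \<in> O[at 0](\<lambda>k. k)"
  proof -
    have "(\<lambda>k. (C k + q * k * (C k)\<^sup>2 - a) - q * (k * (C k)\<^sup>2)) \<in> O[at 0](\<lambda>k. k)"
      using kC2 by (intro sum_in_bigo(2) landau_o.big_trans[OF mass square]) (cases "q = 0", auto)
    then show ?thesis by (simp add: algebra_simps)
  qed
  have "(\<lambda>k. C k + a) \<in> O[at 0](\<lambda>_. 1)"
    using C by (intro sum_in_bigo) auto
  note sq = landau_o.big.mult[OF id landau_o.big.mult[OF diff this]]
  have second: "(\<lambda>k. k * ((C k)\<^sup>2 - a\<^sup>2)) \<in> O[at 0](\<lambda>k. k\<^sup>2)"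
    using sq by (simp add: power2_eq_square algebra_simps)
  have scaled: "(\<lambda>k. r * (k * ((C k)\<^sup>2 - a\<^sup>2))) \<in> O[at 0](\<lambda>k. k\<^sup>2)" for r
    using second by (cases "r = 0") auto
  show "(\<lambda>k. C k + q / 2 * k * (C k)\<^sup>2 - a + q / 2 * k * a\<^sup>2) \<in> O[at 0](\<lambda>k. k\<^sup>2)"
    using sum_in_bigo(2)[OF mass scaled[of "q / 2"]] by (simp add: field_simps)
  have lin: "(\<lambda>k. (C k - a + q * k * a\<^sup>2) / a) \<in> O[at 0](\<lambda>k. k\<^sup>2)"
    using sum_in_bigo(2)[OF mass scaled[of q]] a by (simp add: algebra_simps)
  \<comment> \<open>The logarithm is expanded around 1 at the relative deviation of \<open>C k\<close> from \<open>a\<close>.\<close>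
  have u2: "(\<lambda>k. ((C k - a) / a)\<^sup>2) \<in> O[at 0](\<lambda>k. k\<^sup>2)"
    using landau_o.big.mult[OF diff diff] a by (simp add: power_divide power2_eq_square)
  have "(\<lambda>k::real. k) \<in> o[at 0](\<lambda>_. 1)"
    by (intro smalloI_tendsto) (auto intro: tendsto_eq_intros)
  from smalloD_tendsto[OF landau_o.big_small_trans[OF diff this]]
  have "((\<lambda>k. (C k - a) / a) \<longlongrightarrow> 0) (at 0)"
    by (intro tendsto_divide_zero) simp
  then have small: "\<forall>\<^sub>F k in at 0. \<bar>(C k - a) / a\<bar> \<le> 1 / 2"
    using tendstoD[of _ 0 "at 0" "1 / 2"] by (fastforce elim: eventually_mono simp: dist_real_def)
  have "(\<lambda>k. ln (1 + (C k - a) / a) - (C k - a) / a) \<in> O[at 0](\<lambda>k. ((C k - a) / a)\<^sup>2)"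
  proof (rule bigoI[of _ 2])
    show "\<forall>\<^sub>F k in at 0. norm (ln (1 + (C k - a) / a) - (C k - a) / a) \<le> 2 * norm (((C k - a) / a)\<^sup>2)"
      using small
    proof (rule eventually_mono)
      fix k assume "\<bar>(C k - a) / a\<bar> \<le> 1 / 2"
      from abs_ln_one_plus_x_minus_x_bound[OF this]
      show "norm (ln (1 + (C k - a) / a) - (C k - a) / a) \<le> 2 * norm (((C k - a) / a)\<^sup>2)"
        by (simp only: real_norm_def abs_power2)
    qed
  qed
  from sum_in_bigo(1)[OF landau_o.big_trans[OF this u2] lin]
  have "(\<lambda>k. ln (1 + (C k - a) / a) + q * k * a) \<in> O[at 0](\<lambda>k. k\<^sup>2)"
    using a by (simp add: add_divide_distrib power2_eq_square mult.assoc)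
  moreover have "\<forall>\<^sub>F k in at 0. ln (1 + (C k - a) / a) + q * k * a = ln (C k) - ln a + q * k * a"
    using range
  proof (rule eventually_mono)
    fix k assume "C k \<in> {a / 2..2 * a}"
    then show "ln (1 + (C k - a) / a) + q * k * a = ln (C k) - ln a + q * k * a"
      using a by (simp add: diff_divide_distrib ln_div)
  qed
  ultimately show "(\<lambda>k. ln (C k) - ln a + q * k * a) \<in> O[at 0](\<lambda>k. k\<^sup>2)"
    by (rule landau_o.big.in_cong[THEN iffD1, rotated])
qed


lemma two_powr_half: "2 powr (real n / 2) = sqrt 2 ^ n"
  by (simp add: powr_half_sqrt[symmetric] powr_powr flip: powr_realpow)

theorem proposition2p13:
  fixes \<Omega> :: "(real ^ 'n) set" and \<rho> :: real
    and n C\<^sub>0 :: real and M :: "real \<Rightarrow> real ^ 'n \<Rightarrow> real ^ 'n \<Rightarrow> real"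
  assumes "bounded_domain \<Omega>" and "\<rho> > 0"
  defines "n \<equiv> real CARD('n)"
    and "C\<^sub>0 \<equiv> normalising_const \<Omega> \<rho> 0"
    and "M \<equiv> (\<lambda>k x v. quantum_maxwellian \<Omega> \<rho> k v)"
  shows "(\<lambda>k. energy \<Omega> (M k) - energy \<Omega> (M 0)
              - (- (n * \<rho> * k * C\<^sub>0 / (4 * 2 powr (n / 2))))) \<in> O[at 0](\<lambda>k. k\<^sup>2) \<and>
         (\<lambda>k. entropy \<Omega> k (M k) - entropy \<Omega> 0 (M 0)
              - (- ((n - 2) * \<rho> * k * C\<^sub>0 / (4 * 2 powr (n / 2))))) \<in> O[at 0](\<lambda>k. k\<^sup>2) \<and>
         (\<lambda>k. free_energy \<Omega> k (M k) - free_energy \<Omega> 0 (M 0)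
              - \<rho> * k * C\<^sub>0 / (2 * 2 powr (n / 2))) \<in> O[at 0](\<lambda>k. k\<^sup>2)"
proof -
  define V where "V = measure lborel \<Omega>"
  define Z where "Z = partition_const TYPE(real ^ 'n)"
  define q where "q = 1 / sqrt 2 ^ DIM(real ^ 'n)"
  define a where "a = \<rho> / (V * Z)"
  define C where "C = normalising_const \<Omega> \<rho>"
  define E where "E k = energy \<Omega> (M k)" for k
  define S where "S k = entropy \<Omega> k (M k)" for k
  define L where "L k = V * (LINT v|lborel. log_density k (C k) (v :: real ^ 'n))" for k
  note \<Omega> = \<open>bounded_domain \<Omega>\<close>
  have V: "0 < V" using bounded_domain_measure[OF \<Omega>] by (simp add: V_def)
  have Z: "0 < Z" unfolding Z_def by (rule partition_const_pos)
  have a: "0 < a" using V Z \<open>\<rho> > 0\<close> by (simp add: a_def)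
  have VZa: "V * Z * a = \<rho>" using V Z by (simp add: a_def)
  have n: "real DIM(real ^ 'n) = n" by (simp add: n_def)
  have q: "2 powr (n / 2) = 1 / q"
    by (simp add: n_def q_def two_powr_half)
  have M: "M k = (\<lambda>x. quantum_profile k (C k))" for k
    by (simp add: M_def quantum_maxwellian_def C_def)

  \<comment> \<open>The range of \<open>k\<close> in which the normalising constant is controlled.\<close>
  define near where "near k \<longleftrightarrow> \<bar>k\<bar> * (2 * a) \<le> 1 / 2" for k
  have ev: "\<forall>\<^sub>F k in at 0. near k \<and> k \<noteq> 0"
    unfolding eventually_at near_def using a
    by (intro exI[of _ "1 / (4 * a)"]) (auto simp: field_simps)
  have C: "C k \<in> {a / 2..2 * a}" "0 < C k" "\<bar>k * C k\<bar> \<le> 1 / 2"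
    and mass: "V * (LINT v|lborel. quantum_profile k (C k) (v :: real ^ 'n)) = \<rho>" if "near k" for k
  proof -
    note * = normalising_const_range_and_mass[OF bounded_domain_measure(3)[OF \<Omega>] \<open>\<rho> > 0\<close>, of k,
        folded V_def Z_def C_def, folded a_def]
    show range: "C k \<in> {a / 2..2 * a}"
      using *(1) that unfolding near_def .
    show "V * (LINT v|lborel. quantum_profile k (C k) (v :: real ^ 'n)) = \<rho>"
      using *(2) that unfolding near_def .
    show "0 < C k" using range a by auto
    have "\<bar>k\<bar> * \<bar>C k\<bar> \<le> \<bar>k\<bar> * (2 * a)"
      using range a by (intro mult_left_mono) auto
    then show "\<bar>k * C k\<bar> \<le> 1 / 2"
      using that by (simp add: abs_mult near_def)
  qed
  have near0: "near 0" by (simp add: near_def)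
  have remainder: "f \<in> O[at 0](\<lambda>k. k\<^sup>2)"
    if f: "\<And>k. near k \<Longrightarrow> k \<noteq> 0 \<Longrightarrow> \<bar>f k\<bar> \<le> V * (r * k\<^sup>2 * C k ^ 3 * Z)" and r: "0 \<le> r" for f r
  proof (rule bigoI)
    have "\<bar>f k\<bar> \<le> V * r * (2 * a) ^ 3 * Z * k\<^sup>2" if k: "near k" "k \<noteq> 0" for k
    proof -
      have "C k ^ 3 \<le> (2 * a) ^ 3"
        using C[OF k(1)] by (intro power_mono) auto
      then have "V * (r * k\<^sup>2 * C k ^ 3 * Z) \<le> V * (r * k\<^sup>2 * (2 * a) ^ 3 * Z)"
        using V Z r by (intro mult_left_mono mult_right_mono) auto
      with f[OF k] show ?thesis by (simp only: mult_ac)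
    qed
    then show "\<forall>\<^sub>F k in at 0. norm (f k) \<le> V * r * (2 * a) ^ 3 * Z * norm (k\<^sup>2)"
      using eventually_mono[OF ev] by auto
  qed

  have scale: "\<bar>V * I - V * J\<bar> \<le> V * b" if "\<bar>I - J\<bar> \<le> b" for I J b
    using that V by (simp add: abs_mult flip: right_diff_distrib)
  have mass_remainder: "\<bar>\<rho> - V * (Z * (C k + q * k * (C k)\<^sup>2))\<bar> \<le> V * (2 * k\<^sup>2 * C k ^ 3 * Z)"
    if k: "near k" for k
    using scale[OF mass_expansion(2)[OF C(2,3)[OF k], where 'a = "real ^ 'n", folded Z_def q_def]]
    unfolding mass[OF k] .
  have energy_remainder: "\<bar>E k - V * (n / 2 * Z * (C k + q / 2 * k * (C k)\<^sup>2))\<bar>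
      \<le> V * (n * k\<^sup>2 * C k ^ 3 * Z)" if k: "near k" for k
    using scale[OF energy_expansion(2)[OF C(2,3)[OF k], where 'a = "real ^ 'n", folded Z_def q_def, unfolded n]]
    unfolding E_def M energy_homogeneous[OF \<Omega>] V_def .
  have log_remainder: "\<bar>L k - V * (Z * (C k + q / 2 * k * (C k)\<^sup>2))\<bar>
      \<le> V * (2 * k\<^sup>2 * C k ^ 3 * Z)" if k: "near k" "k \<noteq> 0" for k
    using scale[OF log_expansion(2)[OF C(2,3)[OF k(1)] k(2), where 'a = "real ^ 'n", folded Z_def q_def]]
    unfolding L_def .

  \<comment> \<open>At \<open>k = 0\<close> the remainders vanish, so that the same estimates give the classical values.\<close>
  have "V * Z * C 0 = \<rho>" using mass_remainder[OF near0] by simp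
  then have C0: "C 0 = a" using V Z by (simp add: a_def field_simps)
  then have C0': "C\<^sub>0 = a" by (simp add: C\<^sub>0_def C_def)
  have E0: "E 0 = n / 2 * \<rho>"
    using energy_remainder[OF near0] by (simp add: C0 flip: VZa)
  have S0: "S 0 = - \<rho> * ln a + E 0"
    using entropy_classical[OF \<Omega> a] mass[OF near0] by (simp add: S_def E_def M C0 V_def)
  have Sk: "S k = - \<rho> * ln (C k) + E k - \<rho> + L k" if "near k" "k \<noteq> 0" for k
    using entropy_quantum[OF \<Omega> C(2,3)[OF that(1)] that(2)]
    unfolding V_def[symmetric] mass[OF that(1)] by (simp add: S_def E_def M L_def)

  have "(\<lambda>k. \<rho> - V * (Z * (C k + q * k * (C k)\<^sup>2))) \<in> O[at 0](\<lambda>k. k\<^sup>2)"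
    using mass_remainder by (intro remainder[of _ 2]) auto
  then have "(\<lambda>k. (- 1 / (V * Z)) * (\<rho> - V * (Z * (C k + q * k * (C k)\<^sup>2)))) \<in> O[at 0](\<lambda>k. k\<^sup>2)"
    using V Z by simp
  also have "(\<lambda>k. (- 1 / (V * Z)) * (\<rho> - V * (Z * (C k + q * k * (C k)\<^sup>2))))
      = (\<lambda>k. C k + q * k * (C k)\<^sup>2 - a)"
    using V Z by (simp add: fun_eq_iff field_simps flip: VZa)
  finally have "(\<lambda>k. C k + q * k * (C k)\<^sup>2 - a) \<in> O[at 0](\<lambda>k. k\<^sup>2)" .
  note asymp = fugacity_asymptotics[OF a _ this, OF eventually_mono[OF ev]]
  have T: "(\<lambda>k. r * (C k + q / 2 * k * (C k)\<^sup>2 - a + q / 2 * k * a\<^sup>2)) \<in> O[at 0](\<lambda>k. k\<^sup>2)"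
    and ln: "(\<lambda>k. ln (C k) - ln a + q * k * a) \<in> O[at 0](\<lambda>k. k\<^sup>2)"
    for r
    using asymp C(1) by (cases "r = 0"; simp)+

  have energy: "(\<lambda>k. E k - E 0 + n / 4 * \<rho> * q * k * a) \<in> O[at 0](\<lambda>k. k\<^sup>2)"
  proof -
    have "(\<lambda>k. (E k - V * (n / 2 * Z * (C k + q / 2 * k * (C k)\<^sup>2)))
            + V * (n / 2 * Z) * (C k + q / 2 * k * (C k)\<^sup>2 - a + q / 2 * k * a\<^sup>2)) \<in> O[at 0](\<lambda>k. k\<^sup>2)"
      by (intro sum_in_bigo(1) T remainder[OF energy_remainder]) (simp_all add: n_def)
    then show ?thesis
      by (simp add: E0 algebra_simps power2_eq_square flip: VZa)
  qed
  have log: "(\<lambda>k. L k - \<rho> + \<rho> / 2 * q * k * a) \<in> O[at 0](\<lambda>k. k\<^sup>2)"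
  proof -
    have "(\<lambda>k. (L k - V * (Z * (C k + q / 2 * k * (C k)\<^sup>2)))
            + V * Z * (C k + q / 2 * k * (C k)\<^sup>2 - a + q / 2 * k * a\<^sup>2)) \<in> O[at 0](\<lambda>k. k\<^sup>2)"
      by (intro sum_in_bigo(1) T remainder[OF log_remainder]) simp_all
    then show ?thesis
      by (simp add: algebra_simps power2_eq_square flip: VZa)
  qed
  have entropy: "(\<lambda>k. S k - S 0 + (n - 2) / 4 * \<rho> * q * k * a) \<in> O[at 0](\<lambda>k. k\<^sup>2)"
  proof -
    have "(\<lambda>k. (E k - E 0 + n / 4 * \<rho> * q * k * a) + (L k - \<rho> + \<rho> / 2 * q * k * a)
            - \<rho> * (ln (C k) - ln a + q * k * a)) \<in> O[at 0](\<lambda>k. k\<^sup>2)"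
      using ln \<open>\<rho> > 0\<close> by (intro sum_in_bigo(2)[OF sum_in_bigo(1)[OF energy log]]) simp
    moreover have "\<forall>\<^sub>F k in at 0. (E k - E 0 + n / 4 * \<rho> * q * k * a) + (L k - \<rho> + \<rho> / 2 * q * k * a)
            - \<rho> * (ln (C k) - ln a + q * k * a) = S k - S 0 + (n - 2) / 4 * \<rho> * q * k * a"
      using ev by (rule eventually_mono) (simp add: Sk S0 field_simps)
    ultimately show ?thesis
      by (rule landau_o.big.in_cong[THEN iffD1, rotated])
  qed
  have "(\<lambda>k. (S k - S 0 + (n - 2) / 4 * \<rho> * q * k * a) - (E k - E 0 + n / 4 * \<rho> * q * k * a))
      \<in> O[at 0](\<lambda>k. k\<^sup>2)"
    by (intro sum_in_bigo(2) entropy energy)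
  also have "(\<lambda>k. (S k - S 0 + (n - 2) / 4 * \<rho> * q * k * a) - (E k - E 0 + n / 4 * \<rho> * q * k * a))
      = (\<lambda>k. (S k - E k) - (S 0 - E 0) - \<rho> * q * k * a / 2)"
    by (simp add: fun_eq_iff field_simps)
  finally have free: "(\<lambda>k. (S k - E k) - (S 0 - E 0) - \<rho> * q * k * a / 2) \<in> O[at 0](\<lambda>k. k\<^sup>2)" .
  show ?thesis
    using energy entropy free
    unfolding free_energy_def C0' q E_def[symmetric] S_def[symmetric]
    by (simp add: mult_ac)
qed

end
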